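(* Let $M_3(\mathbb{C})=A\oplus B$ be a direct vector-space sum of two subalgebras with $\dim A=3$ and $\dim B=6$, where $B$ is unital. Then there is a map $\varphi\colon M_3(\mathbb{C})\to M_3(\mathbb{C})$, which is an automorphism or an antiautomorphism of $M_3(\mathbb{C})$, such that $\varphi(B)=\mathrm{Span}\{e_{11},e_{12},e_{13},e_{22},e_{23},e_{33}\}$ and $\varphi(A)=S$, where $S$ is one of the following subalgebras: (T1) $\mathrm{Span}\{e_{21},e_{31},e_{32}\}$; (T2) $\mathrm{Span}\{e_{21}+e_{22},e_{31},e_{32}\}$; (T3) $\mathrm{Span}\{e_{21}+e_{22}+e_{33},e_{31},e_{32}\}$; (T4) $\mathrm{Span}\{e_{21}+e_{22},e_{11}+e_{22}+e_{31},e_{31}+e_{32}\}$; (T5) $\mathrm{Span}\{e_{21}+e_{22},e_{11}+e_{22}+e_{31},e_{12}+e_{21}+e_{32}\}$; (T6) $\mathrm{Span}\{e_{21}+e_{22}+e_{13}-e_{23}+e_{33},\ e_{11}+e_{22}+e_{31},\ e_{12}-e_{22}+e_{32}\}$.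
   Context: $M_3(\mathbb{C})$ is the algebra of $3\times3$ complex matrices, $e_{ij}$ are the matrix units, and $\mathrm{Span}$ means linear span over $\mathbb{C}$. A subalgebra is a $\mathbb{C}$-linear subspace closed under multiplication; it is called unital if it contains the identity matrix. An automorphism is a $\mathbb{C}$-algebra automorphism of $M_3(\mathbb{C})$; an antiautomorphism is the composition of an automorphism and the transpose map. The phrase "up to transpose and up to action of $\mathrm{Aut}(M_3(\mathbb{C}))$" is expressed in the claim by the existence of $\varphi$. *)

theory Defs
  imports "HOL-Analysis.Analysis"
begin

type_synonym mat3 = "complex ^ 3 ^ 3"

text \<open>
  The library's scalar multiplications on \<^typ>\<open>mat3\<close> have scalars in \<^typ>\<open>real\<close> or in
  \<^typ>\<open>complex ^ 3\<close>; linear span, dimension and linearity over the complex numbers are those of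
  the vector space given by the following one.
\<close>

definition mscale :: "complex \<Rightarrow> mat3 \<Rightarrow> mat3" where
  "mscale c X = map_matrix ((*) c) X"

interpretation M3: vector_space mscale
  by unfold_locales (simp_all add: mscale_def vec_eq_iff algebra_simps)

text \<open>In \<^typ>\<open>3\<close>, the numeral \<open>3\<close> equals \<open>0\<close>, so \<open>1, 2, 3\<close> are exactly the three row
  and column indices.\<close>

definition e :: "3 \<Rightarrow> 3 \<Rightarrow> mat3" where
  "e i j = axis i (axis j 1)"

lemma e_nth: "e i j $ r $ s = (if r = i \<and> s = j then 1 else 0)"
  by (simp add: e_def axis_def)

definition subalgebra :: "mat3 set \<Rightarrow> bool" where
  "subalgebra A \<longleftrightarrow> M3.subspace A \<and> (\<forall>X\<in>A. \<forall>Y\<in>A. X ** Y \<in> A)"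

definition unital :: "mat3 set \<Rightarrow> bool" where
  "unital A \<longleftrightarrow> mat 1 \<in> A"

definition direct_sum_decomp :: "mat3 set \<Rightarrow> mat3 set \<Rightarrow> bool" where
  "direct_sum_decomp A B \<longleftrightarrow> {X + Y |X Y. X \<in> A \<and> Y \<in> B} = UNIV \<and> A \<inter> B = {0}"

definition automorphism :: "(mat3 \<Rightarrow> mat3) \<Rightarrow> bool" where
  "automorphism \<phi> \<longleftrightarrow>
     Vector_Spaces.linear mscale mscale \<phi> \<and> bij \<phi> \<and>
     (\<forall>X Y. \<phi> (X ** Y) = \<phi> X ** \<phi> Y) \<and> \<phi> (mat 1) = mat 1"

definition antiautomorphism :: "(mat3 \<Rightarrow> mat3) \<Rightarrow> bool" where
  "antiautomorphism \<phi> \<longleftrightarrow> (\<exists>\<psi>. automorphism \<psi> \<and> \<phi> = \<psi> \<circ> transpose)"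

end

theory Submission
  imports Defs "HOL-Computational_Algebra.Fundamental_Theorem_Algebra"
begin

text \<open>
  The proof has two independent parts.

  First, \<open>B\<close> is conjugate to the algebra of upper triangular matrices (lemma \<open>triangularisable\<close>). Let
  \<open>W\<close> be the annihilator of \<open>B\<close> under the trace form. It is a \<open>B\<close>-bimodule of dimension
  \<open>dim A = 3\<close>, and its elements have trace \<open>0\<close> because \<open>B\<close> is unital. Dimension
  at least \<open>2\<close> suffices for \<open>W\<close> to contain a nonzero singular matrix; if \<open>p\<close> is a nonzero vector in
  its kernel, then the elements of \<open>W\<close> that kill \<open>p\<close> are stable under \<open>B\<close>, and in each possible
  dimension of this space one finds a common eigenvector of \<open>B\<close> (lemma \<open>common_eigenvector\<close>). The same for the transposes gives an invariant plane. Since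
  \<open>dim B = 6\<close>, the plane must contain the eigenvector, so \<open>B\<close> stabilises a full flag.

  Second, the subalgebras \<open>A\<close> complementary to the upper triangular matrices are classified (lemma
  \<open>complementary_classification\<close>). Such an \<open>A\<close> has a unique element for every choice of the
  three entries below the diagonal. Let \<open>a\<close> and \<open>c\<close> be those with entries below the diagonal equal
  to those of \<open>e 2 1\<close> and \<open>e 3 2\<close>. A unitriangular conjugation makes three further entries of \<open>a\<close> and
  \<open>c\<close> vanish, and then the relations \<open>a\<^sup>2 = \<mu> a\<close>, \<open>c\<^sup>2 = \<nu> c\<close>, \<open>a c = \<eta> a + \<zeta> c\<close>, forced by comparing
  entries below the diagonal, determine \<open>A\<close> up to the scalars \<open>\<mu>\<close>, \<open>\<nu>\<close>, \<open>\<zeta> \<in> {0, \<mu>}\<close>, \<open>\<eta> \<in> {0, \<nu>}\<close>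
  with \<open>\<zeta> \<eta> = 0\<close>. Diagonal conjugations scale \<open>\<mu>\<close> and \<open>\<nu>\<close>, the reflection in the antidiagonal
  exchanges \<open>a\<close> and \<open>c\<close>, and a finite list of cases remains. They are the algebras (T1) to (T5);
  (T6) is related to (T4) by an antiautomorphism and so is already covered.
\<close>

section \<open>Coordinates\<close>

abbreviation upper :: "mat3 set" where
  "upper \<equiv> M3.span {e 1 1, e 1 2, e 1 3, e 2 2, e 2 3, e 3 3}"

lemma mscale_nth [simp]: "mscale c X $ i $ j = c * X $ i $ j"
  by (simp add: mscale_def map_matrix_def)

lemma matrix_mult_nth: fixes X Y :: mat3
  shows "(X ** Y) $ i $ j = X $ i $ 1 * Y $ 1 $ j + X $ i $ 2 * Y $ 2 $ j + X $ i $ 3 * Y $ 3 $ j"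
  by (simp add: matrix_matrix_mult_def sum_3)

lemma mat3_eq_iff: fixes X Y :: mat3
  shows "X = Y \<longleftrightarrow> X $ 1 $ 1 = Y $ 1 $ 1 \<and> X $ 1 $ 2 = Y $ 1 $ 2 \<and> X $ 1 $ 3 = Y $ 1 $ 3 \<and>
    X $ 2 $ 1 = Y $ 2 $ 1 \<and> X $ 2 $ 2 = Y $ 2 $ 2 \<and> X $ 2 $ 3 = Y $ 2 $ 3 \<and>
    X $ 3 $ 1 = Y $ 3 $ 1 \<and> X $ 3 $ 2 = Y $ 3 $ 2 \<and> X $ 3 $ 3 = Y $ 3 $ 3"
  by (auto simp: vec_eq_iff forall_3)

lemma mat3_expand: "X = mscale (X $ 1 $ 1) (e 1 1) + mscale (X $ 1 $ 2) (e 1 2) + mscale (X $ 1 $ 3) (e 1 3)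
  + mscale (X $ 2 $ 1) (e 2 1) + mscale (X $ 2 $ 2) (e 2 2) + mscale (X $ 2 $ 3) (e 2 3)
  + mscale (X $ 3 $ 1) (e 3 1) + mscale (X $ 3 $ 2) (e 3 2) + mscale (X $ 3 $ 3) (e 3 3)"
  by (simp add: mat3_eq_iff e_nth)

lemma mem_upper_iff: "X \<in> upper \<longleftrightarrow> X $ 2 $ 1 = 0 \<and> X $ 3 $ 1 = 0 \<and> X $ 3 $ 2 = 0"
proof
  assume "X \<in> upper"
  then show "X $ 2 $ 1 = 0 \<and> X $ 3 $ 1 = 0 \<and> X $ 3 $ 2 = 0"
    by (induction rule: M3.span_induct_alt) (auto simp: e_nth)
next
  assume X: "X $ 2 $ 1 = 0 \<and> X $ 3 $ 1 = 0 \<and> X $ 3 $ 2 = 0"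
  show "X \<in> upper"
    by (subst mat3_expand) (simp add: X, (intro M3.span_add M3.span_scale; rule M3.span_base; simp))
qed

lemma linear_iff: "Vector_Spaces.linear mscale mscale f \<longleftrightarrow>
   (\<forall>X Y. f (X + Y) = f X + f Y) \<and> (\<forall>c X. f (mscale c X) = mscale c (f X))"
  by (auto simp: Vector_Spaces.linear_iff M3.vector_space_axioms)

lemma e_range: "range (\<lambda>(i, j). e i j) = {e 1 1, e 1 2, e 1 3, e 2 1, e 2 2, e 2 3, e 3 1, e 3 2, e 3 3}"
  unfolding UNIV_Times_UNIV [symmetric] UNIV_3 by auto

interpretation M3: finite_dimensional_vector_space mscale "range (\<lambda>(i, j). e i j)"
proof
  show "finite (range (\<lambda>(i, j). e i j))" by simp
  show "M3.span (range (\<lambda>(i, j). e i j)) = UNIV"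
  proof -
    have "X \<in> M3.span (range (\<lambda>(i, j). e i j))" for X
      unfolding e_range by (subst mat3_expand) (intro M3.span_add M3.span_scale; rule M3.span_base; simp)
    then show ?thesis by auto
  qed
  show "M3.independent (range (\<lambda>(i, j). e i j))"
  proof -
    have "e i j \<notin> M3.span (range (\<lambda>(i, j). e i j) - {e i j})" for i j
    proof
      assume "e i j \<in> M3.span (range (\<lambda>(i, j). e i j) - {e i j})"
      then have "e i j $ i $ j = 0"
        by (induction rule: M3.span_induct_alt) (auto simp: e_nth split: if_splits)
      then show False by (simp add: e_nth)
    qed
    then show ?thesis by (auto simp: M3.dependent_def)
  qed
qed

section \<open>Automorphisms and antiautomorphisms\<close>

lemma linear_transpose: "Vector_Spaces.linear mscale mscale (transpose :: mat3 \<Rightarrow> mat3)"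
  by (simp add: linear_iff vec_eq_iff transpose_def)

lemma bij_transpose: "bij (transpose :: mat3 \<Rightarrow> mat3)"
  by (rule o_bij[of transpose]) (auto simp: fun_eq_iff)

text \<open>
  Precomposition with the transpose trades multiplicative for antimultiplicative maps. In this form
  the composition of two maps, each an automorphism or an antiautomorphism, is again one of them.
\<close>

lemma antiautomorphism_iff:
  "antiautomorphism \<phi> \<longleftrightarrow> Vector_Spaces.linear mscale mscale \<phi> \<and> bij \<phi> \<and>
     (\<forall>X Y. \<phi> (X ** Y) = \<phi> Y ** \<phi> X) \<and> \<phi> (mat 1) = mat 1"
proof
  assume "antiautomorphism \<phi>"
  then obtain \<psi> where \<psi>: "automorphism \<psi>" "\<phi> = \<psi> \<circ> transpose"
    unfolding antiautomorphism_def by blast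
  with bij_transpose show "Vector_Spaces.linear mscale mscale \<phi> \<and> bij \<phi> \<and>
     (\<forall>X Y. \<phi> (X ** Y) = \<phi> Y ** \<phi> X) \<and> \<phi> (mat 1) = mat 1"
    unfolding automorphism_def
    by (auto simp: matrix_transpose_mul intro: Vector_Spaces.linear_compose[OF linear_transpose] bij_comp)
next
  assume \<phi>: "Vector_Spaces.linear mscale mscale \<phi> \<and> bij \<phi> \<and>
     (\<forall>X Y. \<phi> (X ** Y) = \<phi> Y ** \<phi> X) \<and> \<phi> (mat 1) = mat 1"
  then have "automorphism (\<phi> \<circ> transpose)"
    using bij_transpose unfolding automorphism_def
    by (auto simp: matrix_transpose_mul intro: Vector_Spaces.linear_compose[OF linear_transpose] bij_comp)
  moreover have "\<phi> = \<phi> \<circ> transpose \<circ> transpose" by (simp add: fun_eq_iff)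
  ultimately show "antiautomorphism \<phi>" unfolding antiautomorphism_def by blast
qed

lemma auto_or_anti_comp:
  assumes "automorphism \<phi> \<or> antiautomorphism \<phi>" "automorphism \<psi> \<or> antiautomorphism \<psi>"
  shows "automorphism (\<psi> \<circ> \<phi>) \<or> antiautomorphism (\<psi> \<circ> \<phi>)"
  using assms unfolding automorphism_def antiautomorphism_iff
  by (auto intro: Vector_Spaces.linear_compose bij_comp)

lemma auto_or_anti_linear:
  "automorphism \<phi> \<or> antiautomorphism \<phi> \<Longrightarrow> Vector_Spaces.linear mscale mscale \<phi>"
  by (auto simp: automorphism_def antiautomorphism_iff)

lemma auto_or_anti_bij: "automorphism \<phi> \<or> antiautomorphism \<phi> \<Longrightarrow> bij \<phi>"
  by (auto simp: automorphism_def antiautomorphism_iff)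

lemma subalgebra_image:
  assumes "subalgebra A" and \<phi>: "automorphism \<phi> \<or> antiautomorphism \<phi>"
  shows "subalgebra (\<phi> ` A)"
proof -
  interpret Vector_Spaces.linear mscale mscale \<phi> using \<phi> by (rule auto_or_anti_linear)
  have "\<phi> X ** \<phi> Y \<in> \<phi> ` A" if "X \<in> A" "Y \<in> A" for X Y
    using \<phi> assms(1) that unfolding automorphism_def antiautomorphism_iff subalgebra_def
    by (metis imageI)
  then show ?thesis
    using assms(1) subspace_image unfolding subalgebra_def by auto
qed

lemma direct_sum_decomp_image:
  assumes "direct_sum_decomp A B" and "Vector_Spaces.linear mscale mscale \<phi>" "bij \<phi>"
  shows "direct_sum_decomp (\<phi> ` A) (\<phi> ` B)"
proof -
  interpret Vector_Spaces.linear mscale mscale \<phi> by fact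
  have "\<exists>X Y. Z = X + Y \<and> X \<in> \<phi> ` A \<and> Y \<in> \<phi> ` B" for Z
  proof -
    obtain Z' where "Z = \<phi> Z'" using \<open>bij \<phi>\<close> by (meson bij_pointE)
    moreover obtain X Y where "Z' = X + Y" "X \<in> A" "Y \<in> B"
      using assms(1) unfolding direct_sum_decomp_def by blast
    ultimately show ?thesis by (metis add imageI)
  qed
  moreover have "\<phi> ` A \<inter> \<phi> ` B = {0}"
    using assms(1,3) zero unfolding direct_sum_decomp_def
    by (metis bij_is_inj image_Int image_insert image_is_empty)
  ultimately show ?thesis unfolding direct_sum_decomp_def by auto
qed

lemma automorphism_conj:
  assumes "g ** h = mat 1"
  shows "automorphism (\<lambda>X. g ** X ** h)"
proof -
  have hg: "h ** g = mat 1" using assms by (simp add: matrix_left_right_inverse)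
  have "g ** (X ** Y) ** h = g ** X ** h ** (g ** Y ** h)" for X Y
    by (metis hg matrix_mul_assoc matrix_mul_lid)
  moreover have "bij (\<lambda>X. g ** X ** h)"
    by (rule o_bij[of "\<lambda>X. h ** X ** g"])
       (auto simp: fun_eq_iff, (metis assms hg matrix_mul_assoc matrix_mul_lid matrix_mul_rid)+)
  moreover have "Vector_Spaces.linear mscale mscale (\<lambda>X. g ** X ** h)"
    unfolding linear_iff by (auto simp: mat3_eq_iff matrix_mult_nth algebra_simps)
  ultimately show ?thesis using assms by (simp add: automorphism_def)
qed

section \<open>Symmetries that preserve the upper triangular matrices\<close>

text \<open>
  The symmetries that remain once one of the two summands is the algebra of upper triangular
  matrices, the stabiliser of the standard flag.
\<close>

definition flag_equiv :: "mat3 set \<Rightarrow> mat3 set \<Rightarrow> bool" where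
  "flag_equiv A A' \<longleftrightarrow>
     (\<exists>\<phi>. (automorphism \<phi> \<or> antiautomorphism \<phi>) \<and> \<phi> ` upper = upper \<and> \<phi> ` A = A')"

lemma flag_equiv_trans: "flag_equiv A A' \<Longrightarrow> flag_equiv A' A'' \<Longrightarrow> flag_equiv A A''"
  unfolding flag_equiv_def
proof (elim exE conjE)
  fix \<phi> \<psi>
  assume "automorphism \<phi> \<or> antiautomorphism \<phi>" "automorphism \<psi> \<or> antiautomorphism \<psi>"
    and img: "\<phi> ` upper = upper" "\<phi> ` A = A'" "\<psi> ` upper = upper" "\<psi> ` A' = A''"
  then have "automorphism (\<psi> \<circ> \<phi>) \<or> antiautomorphism (\<psi> \<circ> \<phi>)"
    by (intro auto_or_anti_comp)
  moreover have "(\<psi> \<circ> \<phi>) ` upper = upper" "(\<psi> \<circ> \<phi>) ` A = A''"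
    using img by (simp_all only: image_comp [symmetric])
  ultimately show "\<exists>\<phi>. (automorphism \<phi> \<or> antiautomorphism \<phi>) \<and> \<phi> ` upper = upper \<and> \<phi> ` A = A''"
    by blast
qed

lemma upper_mult: "X \<in> upper \<Longrightarrow> Y \<in> upper \<Longrightarrow> X ** Y \<in> upper"
  by (simp add: mem_upper_iff matrix_mult_nth)

lemma flag_equiv_conj:
  assumes "g \<in> upper" "h \<in> upper" "g ** h = mat 1"
  shows "flag_equiv A ((\<lambda>X. g ** X ** h) ` A)"
proof -
  have hg: "h ** g = mat 1" using assms by (simp add: matrix_left_right_inverse)
  have "(\<lambda>X. g ** X ** h) ` upper = upper"
  proof (intro equalityI subsetI)
    fix X assume "X \<in> upper"
    then have "h ** X ** g \<in> upper" using assms upper_mult by blast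
    moreover have "X = g ** (h ** X ** g) ** h"
      by (metis assms(3) hg matrix_mul_assoc matrix_mul_lid matrix_mul_rid)
    ultimately show "X \<in> (\<lambda>X. g ** X ** h) ` upper" by blast
  qed (use assms upper_mult in blast)
  with automorphism_conj[OF assms(3)] show ?thesis unfolding flag_equiv_def by blast
qed

text \<open>
  Reflection in the antidiagonal: the transpose followed by reversal of the basis. In the type
  \<^typ>\<open>3\<close> the numeral \<open>4\<close> equals \<open>1\<close>, so the index \<open>4 - i\<close> is \<open>3\<close>, \<open>2\<close>, \<open>1\<close> for
  \<open>i = 1\<close>, \<open>2\<close>, \<open>3\<close>. The plain transpose would turn upper into lower triangular matrices;
  this antiautomorphism keeps the upper ones, and it exchanges \<open>e 2 1\<close> and \<open>e 3 2\<close>.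
\<close>

definition flip :: "mat3 \<Rightarrow> mat3" where
  "flip X = (\<chi> i j. X $ (4 - j) $ (4 - i))"

lemma flip_nth: "flip X $ i $ j = X $ (4 - j) $ (4 - i)"
  by (simp add: flip_def)

lemma flag_equiv_flip: "flag_equiv A (flip ` A)"
proof -
  have inv: "flip (flip X) = X" for X by (simp add: flip_nth vec_eq_iff)
  have "flip (X ** Y) = flip Y ** flip X" for X Y
    by (simp add: mat3_eq_iff flip_nth matrix_mult_nth algebra_simps)
  moreover have "bij flip" by (rule o_bij[of flip]) (auto simp: inv fun_eq_iff)
  moreover have "flip (mat 1) = mat 1" by (simp add: flip_nth mat3_eq_iff mat_def)
  ultimately have "antiautomorphism flip"
    by (simp add: antiautomorphism_iff linear_iff flip_nth vec_eq_iff)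
  moreover have "flip ` upper = upper"
  proof -
    have "flip X \<in> upper" if "X \<in> upper" for X
      using that by (simp add: mem_upper_iff flip_nth)
    then show ?thesis by (metis inv image_eqI subsetI image_subsetI equalityI)
  qed
  ultimately show ?thesis unfolding flag_equiv_def by blast
qed

lemma flag_equiv_refl: "flag_equiv A A"
proof -
  have "mat 1 \<in> upper" by (simp add: mem_upper_iff mat_def)
  from flag_equiv_conj[OF this this] show ?thesis by simp
qed

section \<open>Subalgebras complementary to the upper triangular matrices\<close>

definition complementary :: "mat3 set \<Rightarrow> bool" where
  "complementary A \<longleftrightarrow> subalgebra A \<and> direct_sum_decomp A upper"

lemma complementary_flag_equiv: "complementary A \<Longrightarrow> flag_equiv A A' \<Longrightarrow> complementary A'"
  unfolding complementary_def flag_equiv_def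
proof (elim exE conjE)
  fix \<phi>
  assume \<phi>: "automorphism \<phi> \<or> antiautomorphism \<phi>" and img: "\<phi> ` upper = upper" "\<phi> ` A = A'"
    and A: "subalgebra A" "direct_sum_decomp A upper"
  show "subalgebra A' \<and> direct_sum_decomp A' upper"
    using subalgebra_image[OF A(1) \<phi>] img
      direct_sum_decomp_image[OF A(2) auto_or_anti_linear[OF \<phi>] auto_or_anti_bij[OF \<phi>]]
    by simp
qed

text \<open>
  A complement of the upper triangular matrices is coordinatised by the three entries below the
  diagonal: they can be prescribed, and they determine the element. Every identity between elements
  of a complementary subalgebra is therefore obtained by comparing these three entries, and the
  other six entries of the identity are then equations between the unknown coefficients.
\<close>

lemma complementary_ex:
  assumes "complementary A"
  obtains X where "X \<in> A" "X $ 2 $ 1 = p" "X $ 3 $ 1 = q" "X $ 3 $ 2 = r"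
proof -
  have "mscale p (e 2 1) + mscale q (e 3 1) + mscale r (e 3 2) \<in> {X + Y |X Y. X \<in> A \<and> Y \<in> upper}"
    using assms by (simp add: complementary_def direct_sum_decomp_def)
  then obtain X Y where XY: "X \<in> A" "Y \<in> upper"
    and eq: "mscale p (e 2 1) + mscale q (e 3 1) + mscale r (e 3 2) = X + Y"
    by auto
  show thesis
    by (rule that[OF XY(1)]) (use XY(2) eq in \<open>auto simp: mem_upper_iff mat3_eq_iff e_nth\<close>)
qed

lemma complementary_eqI:
  assumes "complementary A" "X \<in> A" "Y \<in> A"
    and "X $ 2 $ 1 = Y $ 2 $ 1" "X $ 3 $ 1 = Y $ 3 $ 1" "X $ 3 $ 2 = Y $ 3 $ 2"
  shows "X = Y"
proof -
  have "X - Y \<in> A" using assms(1-3) by (auto simp: complementary_def subalgebra_def M3.subspace_diff)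
  moreover have "X - Y \<in> upper" using assms(4-6) by (simp add: mem_upper_iff)
  ultimately have "X - Y \<in> {0}" using assms(1) unfolding complementary_def direct_sum_decomp_def by blast
  then show ?thesis by simp
qed

text \<open>
  The entries \<open>(2, 1)\<close> and \<open>(3, 1)\<close> of the third generator are arbitrary: a triangular system is enough
  to match the coordinates, and the bases of \<open>T4\<close> and \<open>T5\<close> below have this shape.
\<close>

lemma complementary_eq_span:
  assumes "complementary A" "X \<in> A" "Y \<in> A" "Z \<in> A"
    and "X $ 2 $ 1 = 1" "X $ 3 $ 1 = 0" "X $ 3 $ 2 = 0"
    and "Y $ 2 $ 1 = 0" "Y $ 3 $ 1 = 1" "Y $ 3 $ 2 = 0" and "Z $ 3 $ 2 = 1"
  shows "A = M3.span {X, Y, Z}"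
proof
  have A: "M3.subspace A" using assms(1) by (simp add: complementary_def subalgebra_def)
  then show sub: "M3.span {X, Y, Z} \<subseteq> A" using assms(2-4) by (intro M3.span_minimal) auto
  show "A \<subseteq> M3.span {X, Y, Z}"
  proof
    fix U assume U: "U \<in> A"
    let ?V = "mscale (U $ 2 $ 1 - U $ 3 $ 2 * Z $ 2 $ 1) X + mscale (U $ 3 $ 1 - U $ 3 $ 2 * Z $ 3 $ 1) Y
      + mscale (U $ 3 $ 2) Z"
    have V: "?V \<in> M3.span {X, Y, Z}"
      by (intro M3.span_add M3.span_scale; rule M3.span_base; simp)
    have "U = ?V"
      by (rule complementary_eqI[OF assms(1) U]) (use V sub assms(5-) in \<open>auto simp: algebra_simps\<close>)
    with V show "U \<in> M3.span {X, Y, Z}" by simp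
  qed
qed

text \<open>
  Conjugation by unitriangular matrices has three free parameters \<open>x\<close>, \<open>v\<close>, \<open>w\<close>. They make three
  entries vanish: \<open>x\<close> clears \<open>a $ 1 $ 1\<close>, \<open>v\<close> clears \<open>c $ 3 $ 3\<close>, and \<open>w\<close>, which affects neither
  of these, clears \<open>a $ 2 $ 3\<close>.
\<close>

lemma complementary_normalise_flag:
  assumes "complementary A"
  obtains A' a c where "flag_equiv A A'" "complementary A'" "a \<in> A'" "c \<in> A'"
    "a $ 2 $ 1 = 1" "a $ 3 $ 1 = 0" "a $ 3 $ 2 = 0" "a $ 1 $ 1 = 0" "a $ 2 $ 3 = 0"
    "c $ 2 $ 1 = 0" "c $ 3 $ 1 = 0" "c $ 3 $ 2 = 1" "c $ 3 $ 3 = 0"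
proof -
  obtain a where a: "a \<in> A" "a $ 2 $ 1 = 1" "a $ 3 $ 1 = 0" "a $ 3 $ 2 = 0"
    using complementary_ex[OF assms] .
  obtain c where c: "c \<in> A" "c $ 2 $ 1 = 0" "c $ 3 $ 1 = 0" "c $ 3 $ 2 = 1"
    using complementary_ex[OF assms] .
  define x where "x = - a $ 1 $ 1"
  define v where "v = c $ 3 $ 3"
  \<comment> \<open>The entry \<open>(2, 3)\<close> that the conjugate of \<open>a\<close> would have if \<open>w\<close> were \<open>0\<close>.\<close>
  define w where "w = x * v - v * a $ 2 $ 2 + a $ 2 $ 3 + v * a $ 3 $ 3"
  define g where "g = mat 1 + mscale x (e 1 2) + mscale w (e 1 3) + mscale v (e 2 3)"
  define h where "h = mat 1 - mscale x (e 1 2) + mscale (x * v - w) (e 1 3) - mscale v (e 2 3)"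
  note gh = g_def h_def mat_def e_nth matrix_mult_nth
  let ?\<phi> = "\<lambda>X. g ** X ** h"
  have eq: "flag_equiv A (?\<phi> ` A)"
  proof (rule flag_equiv_conj)
    show "g \<in> upper" "h \<in> upper" by (simp_all add: mem_upper_iff gh)
    show "g ** h = mat 1" by (simp add: mat3_eq_iff gh algebra_simps)
  qed
  show thesis
  proof (rule that[of "?\<phi> ` A" "?\<phi> a" "?\<phi> c"])
    show "complementary (?\<phi> ` A)" using complementary_flag_equiv[OF assms eq] .
    show "?\<phi> a $ 2 $ 3 = 0" unfolding w_def
      by (simp add: gh a c w_def algebra_simps)
  qed (use eq a c in \<open>auto simp: gh x_def v_def algebra_simps\<close>)
qed

text \<open>
  Comparing the entries below the diagonal shows \<open>a\<^sup>2 = \<mu> a\<close>, \<open>c\<^sup>2 = \<nu> c\<close> and \<open>a c = \<eta> a + \<zeta> c\<close>,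
  where \<open>\<mu>\<close>, \<open>\<zeta>\<close>, \<open>\<nu>\<close>, \<open>\<eta>\<close> are the diagonal entries of \<open>a\<close> and \<open>c\<close> that remain. The other
  entries of these equations leave only the four parameters and the alternatives stated. The third
  basis element is \<open>c a - \<nu> a - \<mu> c\<close>, whose entries below the diagonal are those of \<open>e 3 1\<close>.
\<close>

lemma complementary_normal_form:
  assumes A: "complementary A" and ac: "a \<in> A" "c \<in> A"
    and a: "a $ 2 $ 1 = 1" "a $ 3 $ 1 = 0" "a $ 3 $ 2 = 0" "a $ 1 $ 1 = 0" "a $ 2 $ 3 = 0"
    and c: "c $ 2 $ 1 = 0" "c $ 3 $ 1 = 0" "c $ 3 $ 2 = 1" "c $ 3 $ 3 = 0"
  obtains \<mu> \<zeta> \<nu> \<eta> where "\<zeta> = 0 \<or> \<zeta> = \<mu>" "\<eta> = 0 \<or> \<eta> = \<nu>" "\<zeta> = 0 \<or> \<eta> = 0"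
    "e 2 1 + mscale \<mu> (e 2 2) + mscale \<zeta> (e 3 3) \<in> A"
    "mscale \<eta> (e 1 1) + mscale (\<eta> * \<mu> + \<zeta> * \<nu> - \<mu> * \<nu>) (e 1 2) + mscale \<nu> (e 2 2) + e 3 2 \<in> A"
    "mscale (\<nu> * (\<zeta> - \<mu>)) (e 1 1) - mscale (\<nu> * \<mu>) (e 2 2) - mscale (\<nu> * \<zeta>) (e 3 3) + e 3 1 \<in> A"
proof -
  have mult: "X ** Y \<in> A" if "X \<in> A" "Y \<in> A" for X Y
    using A that by (simp add: complementary_def subalgebra_def)
  have sub: "M3.subspace A" using A by (simp add: complementary_def subalgebra_def)
  define \<mu> \<zeta> \<nu> \<eta> where "\<mu> = a $ 2 $ 2" and "\<zeta> = a $ 3 $ 3" and "\<nu> = c $ 2 $ 2" and "\<eta> = c $ 1 $ 1"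
  note params = \<mu>_def [symmetric] \<zeta>_def [symmetric] \<nu>_def [symmetric] \<eta>_def [symmetric]
  have "a ** a = mscale \<mu> a"
    by (rule complementary_eqI[OF A]) (simp_all add: mult ac sub M3.subspace_scale matrix_mult_nth a \<mu>_def)
  then have aa: "a $ 1 $ 2 = 0" "a $ 1 $ 3 = 0" "\<zeta> * \<zeta> = \<mu> * \<zeta>"
    by (auto simp: mat3_eq_iff matrix_mult_nth a params)
  have "c ** c = mscale \<nu> c"
    by (rule complementary_eqI[OF A]) (simp_all add: mult ac sub M3.subspace_scale matrix_mult_nth c \<nu>_def)
  then have cc: "c $ 2 $ 3 = 0" "\<eta> * \<eta> = \<nu> * \<eta>" "c $ 1 $ 3 = - \<eta> * c $ 1 $ 2"
    by (auto simp: mat3_eq_iff matrix_mult_nth c params algebra_simps eq_neg_iff_add_eq_0)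
  have "a ** c = mscale \<eta> a + mscale \<zeta> c"
    by (rule complementary_eqI[OF A])
      (simp_all add: mult ac sub M3.subspace_scale M3.subspace_add matrix_mult_nth a c params)
  then have s: "\<zeta> * \<eta> = 0" "\<eta> * c $ 1 $ 2 = 0" "c $ 1 $ 2 = \<eta> * \<mu> + \<zeta> * \<nu> - \<mu> * \<nu>"
    by (auto simp: mat3_eq_iff matrix_mult_nth a c aa cc params algebra_simps)
  from cc(3) s(2) have c13: "c $ 1 $ 3 = 0" by simp
  show thesis
  proof (rule that[of \<zeta> \<mu> \<eta> \<nu>])
    show "\<zeta> = 0 \<or> \<zeta> = \<mu>" "\<eta> = 0 \<or> \<eta> = \<nu>" "\<zeta> = 0 \<or> \<eta> = 0" using aa(3) cc(2) s(1) by auto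
    have "a = e 2 1 + mscale \<mu> (e 2 2) + mscale \<zeta> (e 3 3)"
      by (simp add: mat3_eq_iff e_nth a aa params)
    with ac show "e 2 1 + mscale \<mu> (e 2 2) + mscale \<zeta> (e 3 3) \<in> A" by simp
    have "c = mscale \<eta> (e 1 1) + mscale (\<eta> * \<mu> + \<zeta> * \<nu> - \<mu> * \<nu>) (e 1 2) + mscale \<nu> (e 2 2) + e 3 2"
      using s(3) by (simp add: mat3_eq_iff e_nth c cc(1) c13 params)
    with ac show "mscale \<eta> (e 1 1) + mscale (\<eta> * \<mu> + \<zeta> * \<nu> - \<mu> * \<nu>) (e 1 2) + mscale \<nu> (e 2 2) + e 3 2 \<in> A"
      by simp
    have "c ** a - mscale \<nu> a - mscale \<mu> c \<in> A"
      using ac mult sub by (intro M3.subspace_diff M3.subspace_scale)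
    also have "c ** a - mscale \<nu> a - mscale \<mu> c =
      mscale (\<nu> * (\<zeta> - \<mu>)) (e 1 1) - mscale (\<nu> * \<mu>) (e 2 2) - mscale (\<nu> * \<zeta>) (e 3 3) + e 3 1"
      using s(3) by (simp add: mat3_eq_iff matrix_mult_nth e_nth a c aa cc(1) c13 params algebra_simps)
    finally show "mscale (\<nu> * (\<zeta> - \<mu>)) (e 1 1) - mscale (\<nu> * \<mu>) (e 2 2) - mscale (\<nu> * \<zeta>) (e 3 3) + e 3 1 \<in> A" .
  qed
qed

text \<open>
  The diagonal torus multiplies \<open>e i j\<close> by the quotient of the diagonal entries \<open>i\<close> and \<open>j\<close>; it
  rescales \<open>\<mu>\<close> and \<open>\<nu>\<close> independently. The bases listed in the classification have \<open>\<mu> = 1\<close> and \<open>\<nu> = -1\<close>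
  where these are nonzero.
\<close>

lemma flag_equiv_scale:
  assumes "d \<noteq> 0" "f \<noteq> 0"
  shows "flag_equiv A ((\<lambda>X. (e 1 1 + mscale d (e 2 2) + mscale f (e 3 3)) ** X **
    (e 1 1 + mscale (1 / d) (e 2 2) + mscale (1 / f) (e 3 3))) ` A)"
  by (rule flag_equiv_conj) (use assms in \<open>simp_all add: mem_upper_iff mat3_eq_iff matrix_mult_nth e_nth mat_def\<close>)

abbreviation "T1 \<equiv> M3.span {e 2 1, e 3 1, e 3 2}"
abbreviation "T2 \<equiv> M3.span {e 2 1 + e 2 2, e 3 1, e 3 2}"
abbreviation "T3 \<equiv> M3.span {e 2 1 + e 2 2 + e 3 3, e 3 1, e 3 2}"
abbreviation "T4 \<equiv> M3.span {e 2 1 + e 2 2, e 1 1 + e 2 2 + e 3 1, e 3 1 + e 3 2}"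
abbreviation "T5 \<equiv> M3.span {e 2 1 + e 2 2, e 1 1 + e 2 2 + e 3 1, e 1 2 + e 2 1 + e 3 2}"

lemma flag_equiv_T2_T3:
  assumes A: "complementary A" and "\<mu> \<noteq> 0" and \<zeta>: "\<zeta> = 0 \<or> \<zeta> = \<mu>"
    and mem: "e 2 1 + mscale \<mu> (e 2 2) + mscale \<zeta> (e 3 3) \<in> A" "e 3 1 \<in> A" "e 3 2 \<in> A"
  shows "flag_equiv A T2 \<or> flag_equiv A T3"
proof -
  let ?\<phi> = "\<lambda>X. (e 1 1 + mscale \<mu> (e 2 2) + mscale 1 (e 3 3)) ** X **
    (e 1 1 + mscale (1 / \<mu>) (e 2 2) + mscale (1 / 1) (e 3 3))"
  have eq: "flag_equiv A (?\<phi> ` A)" by (rule flag_equiv_scale) (use \<open>\<mu> \<noteq> 0\<close> in auto)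
  note A' = complementary_flag_equiv[OF A eq]
  have img: "mscale k (?\<phi> X) \<in> ?\<phi> ` A" if "X \<in> A" for k X
    using A' that by (simp add: complementary_def subalgebra_def M3.subspace_scale)
  note entries = mat3_eq_iff e_nth matrix_mult_nth
  have "mscale (1 / \<mu>) (?\<phi> (e 2 1 + mscale \<mu> (e 2 2) + mscale \<zeta> (e 3 3)))
      = e 2 1 + e 2 2 + mscale (\<zeta> / \<mu>) (e 3 3)"
    "mscale 1 (?\<phi> (e 3 1)) = e 3 1" "mscale \<mu> (?\<phi> (e 3 2)) = e 3 2"
    using \<open>\<mu> \<noteq> 0\<close> by (simp_all add: entries)
  with img[OF mem(1)] img[OF mem(2)] img[OF mem(3)]
  have gen: "e 2 1 + e 2 2 + mscale (\<zeta> / \<mu>) (e 3 3) \<in> ?\<phi> ` A" "e 3 1 \<in> ?\<phi> ` A" "e 3 2 \<in> ?\<phi> ` A"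
    by metis+
  have "?\<phi> ` A = M3.span {e 2 1 + e 2 2 + mscale (\<zeta> / \<mu>) (e 3 3), e 3 1, e 3 2}"
    by (rule complementary_eq_span[OF A' gen]) (simp_all add: e_nth)
  then show ?thesis using eq \<zeta> \<open>\<mu> \<noteq> 0\<close> by auto
qed

lemma flag_equiv_T4:
  assumes A: "complementary A" and "\<mu> \<noteq> 0" "\<nu> \<noteq> 0"
    and mem: "e 2 1 + mscale \<mu> (e 2 2) \<in> A"
      "mscale \<nu> (e 1 1 + e 2 2) + e 3 2 \<in> A" "e 3 1 - mscale (\<mu> * \<nu>) (e 1 1 + e 2 2) \<in> A"
  shows "flag_equiv A T4"
proof -
  \<comment> \<open>Up to scalar factors, this conjugation turns \<open>\<mu>\<close> into \<open>1\<close> and \<open>\<nu>\<close> into \<open>-1\<close>.\<close>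
  let ?\<phi> = "\<lambda>X. (e 1 1 + mscale \<mu> (e 2 2) + mscale (- \<mu> * \<nu>) (e 3 3)) ** X **
    (e 1 1 + mscale (1 / \<mu>) (e 2 2) + mscale (1 / (- \<mu> * \<nu>)) (e 3 3))"
  have eq: "flag_equiv A (?\<phi> ` A)" by (rule flag_equiv_scale) (use \<open>\<mu> \<noteq> 0\<close> \<open>\<nu> \<noteq> 0\<close> in auto)
  note A' = complementary_flag_equiv[OF A eq]
  have img: "mscale k (?\<phi> X) \<in> ?\<phi> ` A" if "X \<in> A" for k X
    using A' that by (simp add: complementary_def subalgebra_def M3.subspace_scale)
  note entries = mat3_eq_iff e_nth matrix_mult_nth
  have "mscale (1 / \<mu>) (?\<phi> (e 2 1 + mscale \<mu> (e 2 2))) = e 2 1 + e 2 2"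
    "mscale (- 1 / (\<mu> * \<nu>)) (?\<phi> (e 3 1 - mscale (\<mu> * \<nu>) (e 1 1 + e 2 2))) = e 1 1 + e 2 2 + e 3 1"
    "mscale (- 1 / \<nu>) (?\<phi> (mscale \<nu> (e 1 1 + e 2 2) + e 3 2)) = e 3 2 - e 1 1 - e 2 2"
    using \<open>\<mu> \<noteq> 0\<close> \<open>\<nu> \<noteq> 0\<close> by (simp_all add: entries)
  with img[OF mem(1)] img[OF mem(2)] img[OF mem(3)]
  have gen: "e 2 1 + e 2 2 \<in> ?\<phi> ` A" "e 1 1 + e 2 2 + e 3 1 \<in> ?\<phi> ` A" "e 3 2 - e 1 1 - e 2 2 \<in> ?\<phi> ` A"
    by metis+
  have "(e 1 1 + e 2 2 + e 3 1) + (e 3 2 - e 1 1 - e 2 2) \<in> ?\<phi> ` A"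
    using A' gen(2,3) unfolding complementary_def subalgebra_def by (blast intro: M3.subspace_add)
  then have gen3: "e 3 1 + e 3 2 \<in> ?\<phi> ` A" by (simp add: algebra_simps)
  have "?\<phi> ` A = T4"
    by (rule complementary_eq_span[OF A' gen(1,2) gen3]) (simp_all add: e_nth)
  then show ?thesis using eq by simp
qed

lemma flag_equiv_T5:
  assumes A: "complementary A" and "\<mu> \<noteq> 0" "\<nu> \<noteq> 0"
    and mem: "e 2 1 + mscale \<mu> (e 2 2) \<in> A" "mscale (- \<mu> * \<nu>) (e 1 2) + mscale \<nu> (e 2 2) + e 3 2 \<in> A"
      "e 3 1 - mscale (\<mu> * \<nu>) (e 1 1 + e 2 2) \<in> A"
  shows "flag_equiv A T5"
proof -
  \<comment> \<open>Up to scalar factors, this conjugation turns \<open>\<mu>\<close> into \<open>1\<close> and \<open>\<nu>\<close> into \<open>-1\<close>.\<close>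
  let ?\<phi> = "\<lambda>X. (e 1 1 + mscale \<mu> (e 2 2) + mscale (- \<mu> * \<nu>) (e 3 3)) ** X **
    (e 1 1 + mscale (1 / \<mu>) (e 2 2) + mscale (1 / (- \<mu> * \<nu>)) (e 3 3))"
  have eq: "flag_equiv A (?\<phi> ` A)" by (rule flag_equiv_scale) (use \<open>\<mu> \<noteq> 0\<close> \<open>\<nu> \<noteq> 0\<close> in auto)
  note A' = complementary_flag_equiv[OF A eq]
  have img: "mscale k (?\<phi> X) \<in> ?\<phi> ` A" if "X \<in> A" for k X
    using A' that by (simp add: complementary_def subalgebra_def M3.subspace_scale)
  note entries = mat3_eq_iff e_nth matrix_mult_nth
  have "mscale (1 / \<mu>) (?\<phi> (e 2 1 + mscale \<mu> (e 2 2))) = e 2 1 + e 2 2"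
    "mscale (- 1 / (\<mu> * \<nu>)) (?\<phi> (e 3 1 - mscale (\<mu> * \<nu>) (e 1 1 + e 2 2))) = e 1 1 + e 2 2 + e 3 1"
    "mscale (- 1 / \<nu>) (?\<phi> (mscale (- \<mu> * \<nu>) (e 1 2) + mscale \<nu> (e 2 2) + e 3 2)) = e 1 2 - e 2 2 + e 3 2"
    using \<open>\<mu> \<noteq> 0\<close> \<open>\<nu> \<noteq> 0\<close> by (simp_all add: entries)
  with img[OF mem(1)] img[OF mem(2)] img[OF mem(3)]
  have gen: "e 2 1 + e 2 2 \<in> ?\<phi> ` A" "e 1 1 + e 2 2 + e 3 1 \<in> ?\<phi> ` A" "e 1 2 - e 2 2 + e 3 2 \<in> ?\<phi> ` A"
    by metis+
  have "(e 2 1 + e 2 2) + (e 1 2 - e 2 2 + e 3 2) \<in> ?\<phi> ` A"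
    using A' gen(1,3) unfolding complementary_def subalgebra_def by (blast intro: M3.subspace_add)
  then have gen3: "e 1 2 + e 2 1 + e 3 2 \<in> ?\<phi> ` A" by (simp add: algebra_simps)
  have "?\<phi> ` A = T5"
    by (rule complementary_eq_span[OF A' gen(1,2) gen3]) (simp_all add: e_nth)
  then show ?thesis using eq by simp
qed

text \<open>
  The four parameters of the normal form distinguish the cases. If \<open>\<mu> = \<nu> = 0\<close> the algebra is
  nilpotent. If exactly one of \<open>\<mu>\<close>, \<open>\<nu>\<close> is nonzero, it may be assumed to be \<open>\<mu>\<close>, because
  reflection in the antidiagonal exchanges the pairs \<open>(\<mu>, \<zeta>)\<close> and \<open>(\<nu>, \<eta>)\<close>; then \<open>\<zeta>\<close> separates
  \<open>T2\<close> from \<open>T3\<close>. If both are nonzero, then \<open>\<zeta> = \<eta> = 0\<close> gives \<open>T5\<close>, and the two cases in which one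
  of \<open>\<zeta>\<close>, \<open>\<eta>\<close> is nonzero are reflections of each other and give \<open>T4\<close>.
\<close>

lemma complementary_classification:
  assumes "complementary A"
  shows "\<exists>S \<in> {T1, T2, T3, T4, T5}. flag_equiv A S"
proof -
  obtain A' a c where eq: "flag_equiv A A'" and A': "complementary A'" and ac: "a \<in> A'" "c \<in> A'"
    and entries: "a $ 2 $ 1 = 1" "a $ 3 $ 1 = 0" "a $ 3 $ 2 = 0" "a $ 1 $ 1 = 0" "a $ 2 $ 3 = 0"
    "c $ 2 $ 1 = 0" "c $ 3 $ 1 = 0" "c $ 3 $ 2 = 1" "c $ 3 $ 3 = 0"
    using complementary_normalise_flag[OF assms] .
  obtain \<mu> \<zeta> \<nu> \<eta> where par: "\<zeta> = 0 \<or> \<zeta> = \<mu>" "\<eta> = 0 \<or> \<eta> = \<nu>" "\<zeta> = 0 \<or> \<eta> = 0"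
    and mem: "e 2 1 + mscale \<mu> (e 2 2) + mscale \<zeta> (e 3 3) \<in> A'"
    "mscale \<eta> (e 1 1) + mscale (\<eta> * \<mu> + \<zeta> * \<nu> - \<mu> * \<nu>) (e 1 2) + mscale \<nu> (e 2 2) + e 3 2 \<in> A'"
    "mscale (\<nu> * (\<zeta> - \<mu>)) (e 1 1) - mscale (\<nu> * \<mu>) (e 2 2) - mscale (\<nu> * \<zeta>) (e 3 3) + e 3 1 \<in> A'"
    using complementary_normal_form[OF A' ac entries] .
  note flip = complementary_flag_equiv[OF A' flag_equiv_flip] mem[THEN imageI, of flip]
  have flip_e: "flip (e 2 1 + mscale \<mu> (e 2 2) + mscale \<zeta> (e 3 3)) = mscale \<zeta> (e 1 1) + mscale \<mu> (e 2 2) + e 3 2"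
    "flip (mscale \<eta> (e 1 1) + mscale s (e 1 2) + mscale \<nu> (e 2 2) + e 3 2)
      = e 2 1 + mscale \<nu> (e 2 2) + mscale \<eta> (e 3 3) + mscale s (e 2 3)"
    "flip (mscale p (e 1 1) - mscale q (e 2 2) - mscale r (e 3 3) + e 3 1)
      = e 3 1 - mscale r (e 1 1) - mscale q (e 2 2) + mscale p (e 3 3)" for p q r s
    by (simp_all add: flip_nth mat3_eq_iff e_nth)
  note flip = flip[unfolded flip_e]
  have "\<exists>S \<in> {T1, T2, T3, T4, T5}. flag_equiv A' S"
  proof (cases "\<mu> = 0")
    case True
    then have "\<zeta> = 0" using par by auto
    show ?thesis
    proof (cases "\<nu> = 0")
      case True
      then have "\<eta> = 0" using par by auto
      have "A' = T1"
        by (rule complementary_eq_span[OF A'])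
          (use mem \<open>\<mu> = 0\<close> \<open>\<zeta> = 0\<close> \<open>\<nu> = 0\<close> \<open>\<eta> = 0\<close> in \<open>simp_all add: e_nth\<close>)
      then show ?thesis using flag_equiv_refl by auto
    next
      case False
      have "flag_equiv (flip ` A') T2 \<or> flag_equiv (flip ` A') T3"
        using flip False \<open>\<mu> = 0\<close> \<open>\<zeta> = 0\<close> par(2) by (intro flag_equiv_T2_T3[of _ \<nu> \<eta>]) simp_all
      then show ?thesis using flag_equiv_trans[OF flag_equiv_flip] by blast
    qed
  next
    case \<mu>: False
    show ?thesis
    proof (cases "\<nu> = 0")
      case True
      with par have "\<eta> = 0" by auto
      have "flag_equiv A' T2 \<or> flag_equiv A' T3"
        using mem \<mu> True \<open>\<eta> = 0\<close> par(1) by (intro flag_equiv_T2_T3[OF A', of \<mu> \<zeta>]) simp_all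
      then show ?thesis by blast
    next
      case \<nu>: False
      consider "\<zeta> = 0" "\<eta> = 0" | "\<zeta> = 0" "\<eta> = \<nu>" | "\<zeta> = \<mu>" "\<eta> = 0" using par by auto
      then show ?thesis
      proof cases
        case 1
        have "flag_equiv A' T5"
          using mem 1 by (intro flag_equiv_T5[OF A' \<mu> \<nu>]) (simp_all add: algebra_simps M3.scale_right_distrib)
        then show ?thesis by blast
      next
        case 2
        have "flag_equiv A' T4"
          using mem 2 by (intro flag_equiv_T4[OF A' \<mu> \<nu>]) (simp_all add: algebra_simps M3.scale_right_distrib)
        then show ?thesis by blast
      next
        case 3
        have "flag_equiv (flip ` A') T4"
          using flip 3 by (intro flag_equiv_T4[OF _ \<nu> \<mu>]) (simp_all add: algebra_simps M3.scale_right_distrib)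
        then show ?thesis using flag_equiv_trans[OF flag_equiv_flip] by blast
      qed
    qed
  qed
  then show ?thesis using flag_equiv_trans[OF eq] by blast
qed

section \<open>Triangularisation of unital subalgebras of dimension six\<close>

lemma mscale_mult_vec: "mscale c X *v u = c *s (X *v u)"
  by (simp add: vec_eq_iff matrix_vector_mult_def sum_distrib_left mult.assoc)

lemma mscale_mult [simp]: "mscale c X ** Y = mscale c (X ** Y)"
  by (simp add: mat3_eq_iff matrix_mult_nth algebra_simps)

lemma trace_mscale: "trace (mscale c X) = c * trace X"
  by (simp add: trace_def sum_distrib_left)

definition dot :: "complex ^ 3 \<Rightarrow> complex ^ 3 \<Rightarrow> complex" where
  "dot u v = u $ 1 * v $ 1 + u $ 2 * v $ 2 + u $ 3 * v $ 3"

definition cross :: "complex ^ 3 \<Rightarrow> complex ^ 3 \<Rightarrow> complex ^ 3" where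
  "cross u v = vector [u $ 2 * v $ 3 - u $ 3 * v $ 2, u $ 3 * v $ 1 - u $ 1 * v $ 3,
     u $ 1 * v $ 2 - u $ 2 * v $ 1]"

lemma vec3_eq_iff: "u = v \<longleftrightarrow> u $ 1 = v $ 1 \<and> u $ 2 = v $ 2 \<and> u $ 3 = v $ 3" for u v :: "complex ^ 3"
  by (auto simp: vec_eq_iff forall_3)

lemma cross_cross: "cross u (cross v w) = dot u w *s v - dot u v *s w"
  by (simp add: vec3_eq_iff cross_def dot_def algebra_simps)

lemma dot_row: "dot ((X::mat3) $ i) u = (X *v u) $ i"
  by (simp add: dot_def matrix_vector_mult_def sum_3)

lemma matrix_add_rdistrib: "(X + Y) ** Z = X ** Z + Y ** Z" for X Y Z :: mat3
  by (simp add: mat3_eq_iff matrix_mult_nth algebra_simps)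

lemma matrix_diff_ldistrib: "Z ** (X - Y) = Z ** X - Z ** Y" for X Y Z :: mat3
  by (simp add: mat3_eq_iff matrix_mult_nth algebra_simps)

lemma zero_mult [simp]: "(0::mat3) ** Z = 0" "Z ** (0::mat3) = 0"
  by (simp_all add: mat3_eq_iff matrix_mult_nth)

lemma trace_zero [simp]: "trace (0::mat3) = 0"
  by (simp add: trace_def)

lemma parallel_if_cross_eq_0:
  assumes "cross u v = 0" "v \<noteq> 0"
  shows "\<exists>k. u = k *s v"
proof -
  consider "v $ 1 \<noteq> 0" | "v $ 2 \<noteq> 0" | "v $ 3 \<noteq> 0" using assms(2) by (auto simp: vec3_eq_iff)
  then show ?thesis
  proof cases
    case 1
    then have "u = (u $ 1 / v $ 1) *s v" using assms(1) by (simp add: vec3_eq_iff cross_def field_simps)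
    then show ?thesis ..
  next
    case 2
    then have "u = (u $ 2 / v $ 2) *s v" using assms(1) by (simp add: vec3_eq_iff cross_def field_simps)
    then show ?thesis ..
  next
    case 3
    then have "u = (u $ 3 / v $ 3) *s v" using assms(1) by (simp add: vec3_eq_iff cross_def field_simps)
    then show ?thesis ..
  qed
qed

lemma ex_dot_eq_1:
  assumes "v \<noteq> 0"
  shows "\<exists>w. dot v w = 1"
proof -
  obtain i where "v $ i \<noteq> 0" using assms by (auto simp: vec_eq_iff)
  then have "dot v (axis i (1 / v $ i)) = 1"
    using exhaust_3[of i] by (auto simp: dot_def axis_def)
  then show ?thesis ..
qed

lemma matrix_vector_mult_nth: "((X::mat3) *v u) $ i = X $ i $ 1 * u $ 1 + X $ i $ 2 * u $ 2 + X $ i $ 3 * u $ 3"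
  by (simp add: matrix_vector_mult_def sum_3)

text \<open>
  The determinant of \<open>Y + t Z\<close> is a cubic polynomial in \<open>t\<close> with leading coefficient \<open>det Z\<close>, so it
  has a root.
\<close>

lemma singular_combination:
  fixes Y Z :: mat3
  assumes "det Z \<noteq> 0"
  obtains t where "det (Y + mscale t Z) = 0"
proof -
  define D where "D t = det (Y + mscale t Z)" for t
  \<comment> \<open>The two middle coefficients are recovered from the values at \<open>1\<close> and \<open>-1\<close>.\<close>
  define p where "p = [:det Y, (D 1 - D (-1)) / 2 - det Z, (D 1 + D (-1)) / 2 - det Y, det Z:]"
  have "\<not> constant (poly p)" using assms by (simp add: constant_degree p_def)
  then obtain t where "poly p t = 0" using fundamental_theorem_of_algebra by blast
  moreover have "poly p t = D t" unfolding p_def D_def det_3 by (simp add: field_simps)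
  ultimately show thesis using that by (simp add: D_def)
qed

lemma singular_kernel:
  fixes X :: mat3
  assumes "det X = 0"
  obtains p where "p \<noteq> 0" "X *v p = 0"
  using assms invertible_det_nz[of X] matrix_left_invertible_ker[of X] invertible_left_inverse[of X] by blast

text \<open>
  The set \<open>W\<close> has dimension at least \<open>2\<close>, so it contains a nonzero singular matrix \<open>w\<^sub>0\<close>; let \<open>p\<close>
  be a nonzero vector in its kernel. Multiplication on the left by \<open>B\<close> preserves the space of those \<open>w\<close> in
  \<open>W\<close> that kill \<open>p\<close>.
  If this space is the line through \<open>w\<^sub>0\<close>, then \<open>B\<close> acts on \<open>w\<^sub>0\<close> by scalars, and the vectors in
  the image of \<open>w\<^sub>0\<close> are eigenvectors. If it has dimension \<open>2\<close>, then \<open>W p\<close> is a line, and it is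
  invariant. If it is all of \<open>W\<close>, then \<open>W\<close> kills \<open>B p\<close>; were \<open>p\<close> not an eigenvector, \<open>W\<close> would kill
  a plane, hence consist of all matrices whose rows are multiples of one vector \<open>g \<noteq> 0\<close>, and
  not all of these have trace \<open>0\<close>.
\<close>

lemma common_eigenvector:
  assumes W: "M3.subspace W" "M3.dim W = 3"
    and traceless: "\<And>w. w \<in> W \<Longrightarrow> trace w = 0"
    and left: "\<And>X w. X \<in> B \<Longrightarrow> w \<in> W \<Longrightarrow> X ** w \<in> W"
    and right: "\<And>X w. X \<in> B \<Longrightarrow> w \<in> W \<Longrightarrow> w ** X \<in> W"
  obtains v where "v \<noteq> 0" "\<And>X. X \<in> B \<Longrightarrow> \<exists>k. X *v v = k *s v"
proof -
  obtain w\<^sub>0 where w0: "w\<^sub>0 \<in> W" "w\<^sub>0 \<noteq> 0" "det w\<^sub>0 = 0"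
  proof -
    obtain S where S: "S \<subseteq> W" "M3.independent S" "card S = 3"
      using M3.basis_exists[of W] W(2) by metis
    then obtain y z x where yz: "S = {y, z, x}" "y \<noteq> z" by (auto simp: card_3_iff)
    with S have mem: "y \<in> W" "z \<in> W" by auto
    have z0: "z \<noteq> 0" using S(2) yz M3.dependent_zero[of S] by auto
    show thesis
    proof (cases "det z = 0")
      case False
      then obtain t where t: "det (y + mscale t z) = 0" using singular_combination by blast
      have "y \<notin> M3.span (S - {y})" using S(2) yz unfolding M3.dependent_def by blast
      then have "y \<notin> M3.span {z}" using M3.span_mono[of "{z}" "S - {y}"] yz by auto
      moreover have "y = mscale (- t) z" if "y + mscale t z = 0"
        using that by (simp add: eq_neg_iff_add_eq_0)
      ultimately have "y + mscale t z \<noteq> 0" unfolding M3.span_singleton by blast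
      then show thesis using that t mem W(1) by (meson M3.subspace_add M3.subspace_scale)
    qed (use that mem z0 in blast)
  qed
  then obtain p where p: "p \<noteq> 0" "w\<^sub>0 *v p = 0" using singular_kernel by blast
  show thesis
  proof (cases "\<forall>w \<in> W. w *v p = 0 \<longrightarrow> (\<exists>k. w = mscale k w\<^sub>0)")
    case True
    obtain u where u: "w\<^sub>0 *v u \<noteq> 0" using w0(2) by (metis matrix_eq matrix_vector_mult_0)
    show thesis
    proof (rule that[OF u])
      fix X assume X: "X \<in> B"
      have "(X ** w\<^sub>0) *v p = 0" by (simp add: p flip: matrix_vector_mul_assoc)
      with True left[OF X w0(1)] obtain k where "X ** w\<^sub>0 = mscale k w\<^sub>0" by blast
      then show "\<exists>k. X *v (w\<^sub>0 *v u) = k *s (w\<^sub>0 *v u)"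
        by (metis matrix_vector_mul_assoc mscale_mult_vec)
    qed
  next
    case False
    then obtain w\<^sub>1 where w1: "w\<^sub>1 \<in> W" "w\<^sub>1 *v p = 0" "\<And>k. w\<^sub>1 \<noteq> mscale k w\<^sub>0" by blast
    show thesis
    proof (cases "\<forall>w \<in> W. w *v p = 0")
      case False
      then obtain w\<^sub>2 where w2: "w\<^sub>2 \<in> W" "w\<^sub>2 *v p \<noteq> 0" by blast
      have ker: "M3.span {w\<^sub>1, w\<^sub>0} \<subseteq> {w. w *v p = 0}"
        by (rule M3.span_minimal) (use w1 p in \<open>auto intro!: M3.subspaceI
            simp: matrix_vector_mult_add_rdistrib mscale_mult_vec\<close>)
      have "w\<^sub>1 \<notin> M3.span {w\<^sub>0}" using w1(3) by (auto simp: M3.span_singleton)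
      then have "M3.independent {w\<^sub>1, w\<^sub>0}" using w0(2) by (simp add: M3.independent_insert)
      moreover have "w\<^sub>2 \<notin> M3.span {w\<^sub>1, w\<^sub>0}" using ker w2 by auto
      ultimately have "M3.independent {w\<^sub>2, w\<^sub>1, w\<^sub>0}"
        using w0(2) by (simp add: M3.independent_insert split: if_splits)
      moreover have "w\<^sub>1 \<noteq> w\<^sub>0" "w\<^sub>2 \<noteq> w\<^sub>0" "w\<^sub>2 \<noteq> w\<^sub>1" using w1 w2 p w1(3)[of 1] by auto
      ultimately have "M3.dim (M3.span {w\<^sub>2, w\<^sub>1, w\<^sub>0}) = 3"
        by (simp add: M3.dim_span M3.dim_eq_card_independent)
      then have span: "M3.span {w\<^sub>2, w\<^sub>1, w\<^sub>0} = W"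
        using W w0(1) w1(1) w2(1) by (intro M3.subspace_dim_equal M3.span_minimal) auto
      have line: "M3.span {w\<^sub>2, w\<^sub>1, w\<^sub>0} \<subseteq> {w. \<exists>k. w *v p = k *s (w\<^sub>2 *v p)}"
      proof (rule M3.span_minimal)
        have "w\<^sub>2 *v p = 1 *s (w\<^sub>2 *v p)" "w\<^sub>1 *v p = 0 *s (w\<^sub>2 *v p)" "w\<^sub>0 *v p = 0 *s (w\<^sub>2 *v p)"
          using p w1 by auto
        then show "{w\<^sub>2, w\<^sub>1, w\<^sub>0} \<subseteq> {w. \<exists>k. w *v p = k *s (w\<^sub>2 *v p)}" by blast
        show "M3.subspace {w. \<exists>k. w *v p = k *s (w\<^sub>2 *v p)}"
        proof (rule M3.subspaceI)
          show "0 \<in> {w. \<exists>k. w *v p = k *s (w\<^sub>2 *v p)}" by (auto intro: exI[of _ 0])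
        next
          fix x y assume "x \<in> {w. \<exists>k. w *v p = k *s (w\<^sub>2 *v p)}" "y \<in> {w. \<exists>k. w *v p = k *s (w\<^sub>2 *v p)}"
          then show "x + y \<in> {w. \<exists>k. w *v p = k *s (w\<^sub>2 *v p)}"
            by (auto simp: matrix_vector_mult_add_rdistrib simp flip: vector_sadd_rdistrib)
        next
          fix c x assume "x \<in> {w. \<exists>k. w *v p = k *s (w\<^sub>2 *v p)}"
          then show "mscale c x \<in> {w. \<exists>k. w *v p = k *s (w\<^sub>2 *v p)}"
            by (auto simp: mscale_mult_vec vector_smult_assoc)
        qed
      qed
      show thesis
      proof (rule that[OF w2(2)])
        fix X assume "X \<in> B"
        then have "X ** w\<^sub>2 \<in> M3.span {w\<^sub>2, w\<^sub>1, w\<^sub>0}" using left w2(1) span by simp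
        then show "\<exists>k. X *v (w\<^sub>2 *v p) = k *s (w\<^sub>2 *v p)" using line by (auto simp: matrix_vector_mul_assoc)
      qed
    next
      case ker: True
      show thesis
      proof (rule that[OF p(1)], rule ccontr)
        fix X assume X: "X \<in> B" "\<nexists>k. X *v p = k *s p"
        define g where "g = cross (X *v p) p"
        define G :: "3 \<Rightarrow> mat3" where "G i = (\<chi> r s. if r = i then g $ s else 0)" for i
        have g: "g \<noteq> 0" using X(2) parallel_if_cross_eq_0 p(1) unfolding g_def by blast
        have "W \<subseteq> M3.span {G 1, G 2, G 3}"
        proof
          fix w assume w: "w \<in> W"
          have "w *v p = 0" "w *v (X *v p) = 0"
            using ker w right[OF X(1) w] by (auto simp: matrix_vector_mul_assoc)
          then have "cross (w $ i) g = 0" for i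
            unfolding g_def cross_cross dot_row by simp
          then have "\<forall>i. \<exists>k. w $ i = k *s g" using parallel_if_cross_eq_0 g by blast
          then obtain k where k: "\<And>i. w $ i = k i *s g" by metis
          have "w = mscale (k 1) (G 1) + mscale (k 2) (G 2) + mscale (k 3) (G 3)"
            by (simp add: mat3_eq_iff k G_def)
          also have "\<dots> \<in> M3.span {G 1, G 2, G 3}"
            by (intro M3.span_add M3.span_scale; rule M3.span_base; simp)
          finally show "w \<in> M3.span {G 1, G 2, G 3}" .
        qed
        moreover have "M3.dim (M3.span {G 1, G 2, G 3}) \<le> 3"
          by (rule order_trans[OF M3.dim_le_card[of _ "{G 1, G 2, G 3}"]]) (auto simp: card_insert_if)
        ultimately have "W = M3.span {G 1, G 2, G 3}"
          using W by (intro M3.subspace_dim_equal) auto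
        then have "G 1 \<in> W" "G 2 \<in> W" "G 3 \<in> W" by (auto intro: M3.span_base)
        then have "trace (G 1) = 0" "trace (G 2) = 0" "trace (G 3) = 0" using traceless by auto
        then have "g = 0" by (simp add: trace_def sum_3 G_def vec3_eq_iff)
        with g show False ..
      qed
    qed
  qed
qed

text \<open>
  The functionals vanishing on \<open>B\<close> are represented by matrices through the trace form, so that \<open>B\<close>
  acts on them by multiplication from either side.
\<close>

definition annihilator :: "mat3 set \<Rightarrow> mat3 set" where
  "annihilator B = {w. \<forall>X\<in>B. trace (w ** X) = 0}"

lemma subspace_annihilator: "M3.subspace (annihilator B)"
  by (rule M3.subspaceI) (auto simp: annihilator_def trace_add trace_mscale matrix_add_rdistrib)

lemma trace_mult_e: "trace (X ** e i j) = X $ j $ i"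
  by (simp add: trace_def sum_3 matrix_mult_nth e_nth) (metis exhaust_3)

lemma functional_eq_trace:
  assumes "\<And>X Y. f (X + Y) = f X + f Y" "\<And>c X. f (mscale c X) = c * f X"
  shows "trace ((\<chi> i j. f (e j i)) ** X) = f X"
proof -
  have "f X = f (mscale (X $ 1 $ 1) (e 1 1) + mscale (X $ 1 $ 2) (e 1 2) + mscale (X $ 1 $ 3) (e 1 3)
    + mscale (X $ 2 $ 1) (e 2 1) + mscale (X $ 2 $ 2) (e 2 2) + mscale (X $ 2 $ 3) (e 2 3)
    + mscale (X $ 3 $ 1) (e 3 1) + mscale (X $ 3 $ 2) (e 3 2) + mscale (X $ 3 $ 3) (e 3 3))"
    by (rule arg_cong[OF mat3_expand])
  then show ?thesis by (simp add: assms trace_def sum_3 matrix_mult_nth algebra_simps)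
qed

text \<open>
  Functionals on the whole space that vanish on \<open>B\<close> are the same as functionals on \<open>A\<close>, via the
  projection \<open>P\<close> onto \<open>A\<close> along \<open>B\<close>; and every functional is \<open>X \<mapsto> trace (w ** X)\<close> for one \<open>w\<close>.
  The coordinate functionals of a basis of \<open>A\<close> thus give a basis of the annihilator.
\<close>

lemma dim_annihilator:
  assumes A: "M3.subspace A" and B: "M3.subspace B" and AB: "direct_sum_decomp A B"
  shows "M3.dim (annihilator B) = M3.dim A"
proof -
  obtain S where S: "S \<subseteq> A" "M3.independent S" "A \<subseteq> M3.span S" "card S = M3.dim A"
    using M3.basis_exists[of A] by metis
  have finS: "finite S" using S(2) M3.finiteI_independent by blast
  have spanS: "M3.span S = A" using S A by (simp add: M3.span_minimal subset_antisym)
  define P where "P X = (THE a. a \<in> A \<and> X - a \<in> B)" for X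
  have P_eqI: "P X = a" if "a \<in> A" "X - a \<in> B" for X a
    unfolding P_def
  proof (rule the_equality)
    fix a' assume a': "a' \<in> A \<and> X - a' \<in> B"
    have "a' - a \<in> A" using a' that A M3.subspace_diff by blast
    moreover have "(X - a) - (X - a') \<in> B" using a' that B M3.subspace_diff by blast
    then have "a' - a \<in> B" by simp
    ultimately have "a' - a \<in> A \<inter> B" by (rule IntI)
    also have "A \<inter> B = {0}" using AB by (simp add: direct_sum_decomp_def)
    finally show "a' = a" by simp
  qed (use that in simp)
  have P: "P X \<in> A" "X - P X \<in> B" for X
  proof -
    have "X \<in> {X + Y |X Y. X \<in> A \<and> Y \<in> B}" using AB by (simp add: direct_sum_decomp_def)
    then obtain a b where ab: "X = a + b" "a \<in> A" "b \<in> B" by blast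
    then have "P X = a" by (intro P_eqI) auto
    then show "P X \<in> A" "X - P X \<in> B" using ab by auto
  qed
  have P_add: "P (X + Y) = P X + P Y" for X Y
    using P[of X] P[of Y] A B M3.subspace_add[of B "X - P X" "Y - P Y"]
    by (intro P_eqI) (auto simp: M3.subspace_add algebra_simps)
  have P_scale: "P (mscale c X) = mscale c (P X)" for c X
    using P[of X] A B M3.subspace_scale[of B "X - P X" c]
    by (intro P_eqI) (auto simp: M3.subspace_scale M3.scale_right_diff_distrib)
  define f where "f a X = M3.representation S (P X) a" for a X
  define w :: "mat3 \<Rightarrow> mat3" where "w a = (\<chi> i j. f a (e j i))" for a
  have w: "trace (w a ** X) = f a X" for a X
    unfolding w_def
    by (rule functional_eq_trace) (use S P in \<open>simp_all add: f_def P_add P_scale spanS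
        M3.representation_add M3.representation_scale\<close>)
  have fS: "f a b = (if a = b then 1 else 0)" if "b \<in> S" for a b
  proof -
    have "P b = b" using that S B by (intro P_eqI) (auto simp: M3.subspace_0)
    then show ?thesis using that S by (simp add: f_def M3.representation_basis)
  qed
  show ?thesis
  proof (rule M3.dim_unique)
    have "f a Y = 0" if "Y \<in> B" for a Y
    proof -
      have "P Y = 0" using that A by (intro P_eqI) (auto simp: M3.subspace_0)
      then show ?thesis by (simp add: f_def M3.representation_zero)
    qed
    then show "w ` S \<subseteq> annihilator B" by (auto simp: annihilator_def w)
    have "inj_on w S" by (rule inj_onI) (metis w fS zero_neq_one)
    then show "card (w ` S) = M3.dim A" using S(4) by (simp add: card_image)
    show "M3.independent (w ` S)"
      unfolding M3.dependent_def
    proof (intro notI, elim bexE)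
      fix x assume x: "x \<in> w ` S" "x \<in> M3.span (w ` S - {x})"
      then obtain a where a: "a \<in> S" "x = w a" by auto
      have "M3.span (w ` S - {x}) \<subseteq> {y. trace (y ** a) = 0}"
        by (rule M3.span_minimal) (use a in \<open>auto intro!: M3.subspaceI simp: w fS
          matrix_add_rdistrib trace_add trace_mscale\<close>)
      then show False using x(2) a by (auto simp: w fS)
    qed
    show "annihilator B \<subseteq> M3.span (w ` S)"
    proof
      fix x assume x: "x \<in> annihilator B"
      define y where "y = (\<Sum>a\<in>S. mscale (trace (x ** a)) (w a))"
      have y: "trace (y ** Z) = (\<Sum>a\<in>S. trace (x ** a) * f a Z)" for Z
        unfolding y_def using finS
        by (induction S rule: finite_induct)
          (simp_all add: matrix_add_rdistrib trace_add trace_mscale w)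
      have "trace (x ** Z) = trace (y ** Z)" for Z
      proof -
        have "trace (x ** (Z - P Z)) = 0" using x P(2)[of Z] by (auto simp: annihilator_def)
        then have "trace (x ** Z) = trace (x ** P Z)" by (simp add: matrix_diff_ldistrib trace_sub)
        moreover have "P Z = (\<Sum>a\<in>S. mscale (f a Z) a)"
          unfolding f_def by (rule M3.sum_representation_eq [symmetric]) (use S P spanS finS in auto)
        moreover have "trace (x ** (\<Sum>a\<in>S. mscale (c a) a)) = (\<Sum>a\<in>S. trace (x ** a) * c a)"
          for c :: "mat3 \<Rightarrow> complex"
          using finS
        proof (induction S rule: finite_induct)
          case (insert b S)
          have "x ** mscale (c b) b = mscale (c b) (x ** b)"
            by (simp add: mat3_eq_iff matrix_mult_nth algebra_simps)
          then show ?case using insert by (simp add: matrix_add_ldistrib trace_add trace_mscale)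
        qed simp
        ultimately show ?thesis by (simp add: y)
      qed
      then have "x = y" by (metis trace_mult_e vec_eq_iff)
      moreover have "y \<in> M3.span (w ` S)"
        unfolding y_def by (intro M3.span_sum M3.span_scale M3.span_base) auto
      ultimately show "x \<in> M3.span (w ` S)" by simp
    qed
  qed
qed

lemma dim_image_inj:
  assumes "Vector_Spaces.linear mscale mscale \<phi>" "inj \<phi>"
  shows "M3.dim (\<phi> ` S) = M3.dim S"
proof -
  interpret finite_dimensional_vector_space_pair_1 mscale "range (\<lambda>(i, j). e i j)" mscale
    by unfold_locales
  show ?thesis using assms by (intro dim_image_eq) (auto intro: inj_on_subset)
qed

lemma transpose_mult: "transpose (X ** Y :: mat3) = transpose Y ** transpose X"
  by (simp add: matrix_transpose_mul)

lemma trace_transpose: "trace (transpose (X::mat3)) = trace X"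
  by (simp add: trace_def transpose_def)

text \<open>
  The annihilator \<open>W\<close> of \<open>B\<close> is stable under multiplication by \<open>B\<close> from both sides, because the trace
  form is invariant, and it is traceless, because \<open>B\<close> contains the identity. Transposition
  preserves all these properties, so that there is also a common eigenvector of the transposes.
\<close>

lemma eigenvector_and_left_eigenvector:
  assumes A: "subalgebra A" and B: "subalgebra B" "unital B" and AB: "direct_sum_decomp A B"
    and "M3.dim A = 3"
  obtains v f where "v \<noteq> 0" "f \<noteq> 0" "\<And>X. X \<in> B \<Longrightarrow> \<exists>k. X *v v = k *s v"
    "\<And>X. X \<in> B \<Longrightarrow> \<exists>k. transpose X *v f = k *s f"
proof -
  let ?W = "annihilator B"
  have W: "M3.subspace ?W" "M3.dim ?W = 3"
    using assms dim_annihilator[of A B] by (simp_all add: subspace_annihilator subalgebra_def)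
  have mult: "X ** Y \<in> B" if "X \<in> B" "Y \<in> B" for X Y using B(1) that by (simp add: subalgebra_def)
  have traceless: "trace w = 0" if "w \<in> ?W" for w
  proof -
    have "trace (w ** mat 1) = 0" using that B(2) by (auto simp: annihilator_def unital_def)
    then show ?thesis by simp
  qed
  have right: "w ** X \<in> ?W" if "X \<in> B" "w \<in> ?W" for X w
    using that mult by (auto simp: annihilator_def simp flip: matrix_mul_assoc)
  have left: "X ** w \<in> ?W" if "X \<in> B" "w \<in> ?W" for X w
    unfolding annihilator_def
  proof (intro CollectI ballI)
    fix Y assume "Y \<in> B"
    then have "trace (w ** (Y ** X)) = 0" using that mult by (auto simp: annihilator_def)
    then show "trace (X ** w ** Y) = 0"
      by (metis matrix_mul_assoc trace_mul_sym)
  qed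
  obtain v where v: "v \<noteq> 0" "\<And>X. X \<in> B \<Longrightarrow> \<exists>k. X *v v = k *s v"
    by (rule common_eigenvector[OF W traceless left right]) blast+
  obtain f where f: "f \<noteq> 0" "\<And>X. X \<in> transpose ` B \<Longrightarrow> \<exists>k. X *v f = k *s f"
  proof (rule common_eigenvector)
    interpret Vector_Spaces.linear mscale mscale "transpose :: mat3 \<Rightarrow> mat3" by (rule linear_transpose)
    show "M3.subspace (transpose ` ?W)" using W(1) by (rule subspace_image)
    show "M3.dim (transpose ` ?W) = 3"
      using W(2) dim_image_inj[OF linear_transpose bij_is_inj[OF bij_transpose]] by simp
    show "trace w = 0" if "w \<in> transpose ` ?W" for w
      using that traceless by (auto simp: trace_transpose)
    show "X ** w \<in> transpose ` ?W" if "X \<in> transpose ` B" "w \<in> transpose ` ?W" for X w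
      using that right by (auto simp flip: transpose_mult)
    show "w ** X \<in> transpose ` ?W" if "X \<in> transpose ` B" "w \<in> transpose ` ?W" for X w
      using that left by (auto simp flip: transpose_mult)
  qed blast
  show thesis using that v f by blast
qed

lemma conj_column:
  fixes g h X :: mat3
  assumes "g ** h = mat 1" and "X *v column j h = k *s column j h"
  shows "(g ** X ** h) $ i $ j = (if i = j then k else 0)"
proof -
  have "(g ** X ** h) $ i $ j = (g *v (X *v column j h)) $ i"
    by (simp add: matrix_mult_nth matrix_vector_mult_nth column_def algebra_simps)
  also have "\<dots> = k * (g ** h) $ i $ j"
    unfolding assms(2) by (simp add: matrix_mult_nth matrix_vector_mult_nth column_def algebra_simps)
  finally show ?thesis by (simp add: assms(1) mat_def)
qed

lemma matrix_vector_mult_axis: "X *v axis i 1 = column i X" for X :: mat3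
  using exhaust_3[of i] by (auto simp: vec_eq_iff matrix_vector_mult_nth column_def axis_def)

lemma conj_row:
  fixes g h X :: mat3
  assumes gh: "g ** h = mat 1" and f: "transpose X *v f = k *s f"
    and \<gamma>: "transpose h *v f = \<gamma> *s axis i 1" "\<gamma> \<noteq> 0"
  shows "(g ** X ** h) $ i $ j = (if i = j then k else 0)"
proof -
  have hg: "transpose h ** transpose g = mat 1" "transpose g ** transpose h = mat 1"
    using gh matrix_left_right_inverse[of g h] by (simp_all flip: transpose_mult)
  have "f = transpose g *v (transpose h *v f)"
    by (simp only: matrix_vector_mul_assoc hg matrix_vector_mul_lid)
  also have "\<dots> = \<gamma> *s column i (transpose g)"
    by (simp only: \<gamma>(1) vector_scalar_commute matrix_vector_mult_axis)
  finally have "column i (transpose g) = (1 / \<gamma>) *s f" using \<gamma>(2) by (simp add: vec_eq_iff)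
  then have "transpose X *v column i (transpose g) = k *s column i (transpose g)"
    using f by (simp add: vector_scalar_commute mult.commute)
  from conj_column[OF hg(1) this, of j] show ?thesis
    by (simp add: transpose_mult [symmetric] matrix_mul_assoc) (auto simp: transpose_def)
qed

lemma dim_block_diagonal: "M3.dim {X. X $ 1 $ 2 = 0 \<and> X $ 1 $ 3 = 0 \<and> X $ 2 $ 1 = 0 \<and> X $ 3 $ 1 = 0} \<le> 5"
proof -
  have "X \<in> M3.span {e 1 1, e 2 2, e 2 3, e 3 2, e 3 3}"
    if "X $ 1 $ 2 = 0 \<and> X $ 1 $ 3 = 0 \<and> X $ 2 $ 1 = 0 \<and> X $ 3 $ 1 = 0" for X
    by (subst mat3_expand) (simp add: that, (intro M3.span_add M3.span_scale; rule M3.span_base; simp))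
  then have "M3.dim {X. X $ 1 $ 2 = 0 \<and> X $ 1 $ 3 = 0 \<and> X $ 2 $ 1 = 0 \<and> X $ 3 $ 1 = 0}
      \<le> card {e 1 1, e 2 2, e 2 3, e 3 2, e 3 3}"
    by (intro M3.dim_le_card) auto
  also have "\<dots> \<le> 5" by (simp add: card_insert_if)
  finally show ?thesis .
qed

lemma dim_upper: "M3.dim upper \<le> 6"
  by (rule order_trans[OF M3.dim_le_card[of _ "{e 1 1, e 1 2, e 1 3, e 2 2, e 2 3, e 3 3}"]])
    (auto simp: card_insert_if)

definition of_columns :: "complex ^ 3 \<Rightarrow> complex ^ 3 \<Rightarrow> complex ^ 3 \<Rightarrow> mat3" where
  "of_columns u v w = transpose (vector [u, v, w])"

lemma det_of_columns: "det (of_columns u v w) = dot u (cross v w)"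
  unfolding of_columns_def det_transpose by (simp add: det_3 dot_def cross_def algebra_simps)

lemma column_of_columns: "column 1 (of_columns u v w) = u"
  by (simp add: of_columns_def column_def transpose_def vec_eq_iff)

lemma transpose_of_columns_mult: "transpose (of_columns u v w) *v f = vector [dot f u, dot f v, dot f w]"
  by (simp add: of_columns_def vec3_eq_iff matrix_vector_mult_nth dot_def mult.commute)

text \<open>
  The kernel of the left eigenvector \<open>f\<close> is an invariant plane. If it did not contain the
  eigenvector \<open>v\<close>, then \<open>B\<close> would preserve a decomposition into a line and a plane, and its
  dimension would be at most \<open>5\<close>. Hence the line and the plane form an invariant flag, and in a basis
  adapted to it \<open>B\<close> consists of upper triangular matrices; the dimension then forces equality.
  Cross products with \<open>f\<close> supply vectors in the kernel of \<open>f\<close> with a computable determinant.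
\<close>

lemma triangularisable:
  assumes "subalgebra A" and B: "subalgebra B" "unital B" "direct_sum_decomp A B"
    and dim: "M3.dim A = 3" "M3.dim B = 6"
  obtains g h where "g ** h = mat 1" "(\<lambda>X. g ** X ** h) ` B = upper"
proof -
  obtain v f where vf: "v \<noteq> 0" "f \<noteq> 0" and v: "\<And>X. X \<in> B \<Longrightarrow> \<exists>k. X *v v = k *s v"
    and f: "\<And>X. X \<in> B \<Longrightarrow> \<exists>k. transpose X *v f = k *s f"
    using eigenvector_and_left_eigenvector[OF assms(1-5)] by blast
  have dim_conj: "M3.dim ((\<lambda>X. g ** X ** h) ` B) = 6" "M3.subspace ((\<lambda>X. g ** X ** h) ` B)"
    if "g ** h = mat 1" for g h
  proof -
    have aut: "automorphism (\<lambda>X. g ** X ** h)" using automorphism_conj[OF that] .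
    then show "M3.dim ((\<lambda>X. g ** X ** h) ` B) = 6"
      using dim(2) dim_image_inj unfolding automorphism_def by (metis bij_is_inj)
    show "M3.subspace ((\<lambda>X. g ** X ** h) ` B)"
      using subalgebra_image[OF B(1)] aut unfolding subalgebra_def by blast
  qed
  have inverse: "\<exists>g. g ** h = mat 1" if "det h \<noteq> 0" for h :: mat3
    using that by (meson invertible_det_nz invertible_left_inverse)
  have fv: "dot f v = 0"
  proof (rule ccontr)
    assume fv: "dot f v \<noteq> 0"
    obtain w w' where w: "dot f (cross w w') \<noteq> 0"
    proof -
      consider "f $ 1 \<noteq> 0" | "f $ 2 \<noteq> 0" | "f $ 3 \<noteq> 0" using vf(2) by (auto simp: vec3_eq_iff)
      then show thesis
      proof cases
        case 1
        then show thesis by (intro that[of "axis 2 1" "axis 3 1"]) (simp add: dot_def cross_def axis_def)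
      next
        case 2
        then show thesis by (intro that[of "axis 3 1" "axis 1 1"]) (simp add: dot_def cross_def axis_def)
      next
        case 3
        then show thesis by (intro that[of "axis 1 1" "axis 2 1"]) (simp add: dot_def cross_def axis_def)
      qed
    qed
    define h where "h = of_columns v (cross f w) (cross f w')"
    have "det h = dot f v * dot f (cross w w')"
      unfolding h_def det_of_columns by (simp add: dot_def cross_def algebra_simps)
    then obtain g where g: "g ** h = mat 1" using fv w inverse[of h] by auto
    have row: "transpose h *v f = dot f v *s axis 1 1"
      unfolding h_def transpose_of_columns_mult
      by (simp add: vec3_eq_iff axis_def dot_def cross_def algebra_simps)
    have "(\<lambda>X. g ** X ** h) ` B \<subseteq> {X. X $ 1 $ 2 = 0 \<and> X $ 1 $ 3 = 0 \<and> X $ 2 $ 1 = 0 \<and> X $ 3 $ 1 = 0}"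
    proof (intro image_subsetI CollectI)
      fix X assume X: "X \<in> B"
      obtain k where k: "X *v v = k *s v" using v X by blast
      obtain l where l: "transpose X *v f = l *s f" using f X by blast
      have "(g ** X ** h) $ i $ 1 = (if i = 1 then k else 0)" for i
        by (rule conj_column[OF g]) (simp add: h_def column_of_columns k)
      moreover have "(g ** X ** h) $ 1 $ j = (if 1 = j then l else 0)" for j
        by (rule conj_row[OF g l row fv])
      ultimately show "(g ** X ** h) $ 1 $ 2 = 0 \<and> (g ** X ** h) $ 1 $ 3 = 0 \<and>
          (g ** X ** h) $ 2 $ 1 = 0 \<and> (g ** X ** h) $ 3 $ 1 = 0" by simp
    qed
    from M3.dim_subset[OF this] dim_conj(1)[OF g] dim_block_diagonal show False by simp
  qed
  obtain w where w: "dot v w = 1" using ex_dot_eq_1[OF vf(1)] ..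
  obtain u where u: "dot f u = 1" using ex_dot_eq_1[OF vf(2)] ..
  define h where "h = of_columns v (cross f w) u"
  have "det h = dot v w * dot f u - dot f v * dot w u"
    unfolding h_def det_of_columns by (simp add: dot_def cross_def algebra_simps)
  then obtain g where g: "g ** h = mat 1" using fv w u inverse[of h] by auto
  have row: "transpose h *v f = 1 *s axis 3 1"
    unfolding h_def transpose_of_columns_mult fv u
    by (simp add: vec3_eq_iff axis_def dot_def cross_def algebra_simps)
  have "(\<lambda>X. g ** X ** h) ` B \<subseteq> upper"
  proof (intro image_subsetI)
    fix X assume X: "X \<in> B"
    obtain k where k: "X *v v = k *s v" using v X by blast
    obtain l where l: "transpose X *v f = l *s f" using f X by blast
    have "(g ** X ** h) $ i $ 1 = (if i = 1 then k else 0)" for i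
      by (rule conj_column[OF g]) (simp add: h_def column_of_columns k)
    moreover have "(g ** X ** h) $ 3 $ j = (if 3 = j then l else 0)" for j
      by (rule conj_row[OF g l row]) simp
    ultimately show "g ** X ** h \<in> upper" unfolding mem_upper_iff by simp
  qed
  then have "(\<lambda>X. g ** X ** h) ` B = upper"
    using dim_conj[OF g] dim_upper by (intro M3.subspace_dim_equal) auto
  with that[OF g] show thesis .
qed

section \<open>Decompositions into subalgebras of dimensions three and six\<close>

theorem theorem3:
  fixes A B :: "mat3 set"
  assumes "subalgebra A" and "subalgebra B"
    and "direct_sum_decomp A B"
    and "M3.dim A = 3" and "M3.dim B = 6"
    and "unital B"
  shows "\<exists>\<phi>. (automorphism \<phi> \<or> antiautomorphism \<phi>) \<and>
    \<phi> ` B = M3.span {e 1 1, e 1 2, e 1 3, e 2 2, e 2 3, e 3 3} \<and>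
    \<phi> ` A \<in>
      {M3.span {e 2 1, e 3 1, e 3 2},
       M3.span {e 2 1 + e 2 2, e 3 1, e 3 2},
       M3.span {e 2 1 + e 2 2 + e 3 3, e 3 1, e 3 2},
       M3.span {e 2 1 + e 2 2, e 1 1 + e 2 2 + e 3 1, e 3 1 + e 3 2},
       M3.span {e 2 1 + e 2 2, e 1 1 + e 2 2 + e 3 1, e 1 2 + e 2 1 + e 3 2},
       M3.span {e 2 1 + e 2 2 + e 1 3 - e 2 3 + e 3 3, e 1 1 + e 2 2 + e 3 1,
                e 1 2 - e 2 2 + e 3 2}}"
proof -
  obtain g h where gh: "g ** h = mat 1" and B: "(\<lambda>X. g ** X ** h) ` B = upper"
    using triangularisable[OF assms(1,2,6,3-5)] .
  let ?\<psi> = "\<lambda>X. g ** X ** h"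
  have \<psi>: "automorphism ?\<psi>" by (rule automorphism_conj[OF gh])
  then have "direct_sum_decomp (?\<psi> ` A) (?\<psi> ` B)"
    using assms(3) by (intro direct_sum_decomp_image) (simp_all add: automorphism_def)
  then have "complementary (?\<psi> ` A)"
    using subalgebra_image[OF assms(1)] \<psi> unfolding complementary_def B by blast
  from complementary_classification[OF this]
  obtain S where S: "S \<in> {T1, T2, T3, T4, T5}" and "flag_equiv (?\<psi> ` A) S" ..
  then obtain \<phi> where \<phi>: "automorphism \<phi> \<or> antiautomorphism \<phi>" "\<phi> ` upper = upper"
    and A: "\<phi> ` ?\<psi> ` A = S"
    unfolding flag_equiv_def by blast
  have "automorphism (\<phi> \<circ> ?\<psi>) \<or> antiautomorphism (\<phi> \<circ> ?\<psi>)"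
    using auto_or_anti_comp \<phi>(1) \<psi> by blast
  moreover have "(\<phi> \<circ> ?\<psi>) ` B = upper" by (simp only: image_comp [symmetric] B \<phi>(2))
  moreover have "(\<phi> \<circ> ?\<psi>) ` A = S" by (simp only: image_comp [symmetric] A)
  ultimately show ?thesis using S by blast
qed

end
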